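(* Let $X$ be a poset and $K$ a field with $|K|>2$. Then the unital linear invertibility preservers of $FI(X,K)$ are exactly the maps $\varphi:FI(X,K)\to FI(X,K)$ of the form $$\varphi(\alpha)=\sum_{k\in K}k\,e_{\lambda(L_k(\alpha))}+\psi(\alpha)\qquad(\alpha\in FI(X,K)),$$ where $\lambda$ is a $|K|$-complete endomorphism of the Boolean algebra $\mathcal{P}(X)$ and $\psi:FI(X,K)\to J(FI(X,K))$ is a linear map with $\psi(\delta)=0$.
   Context: The finitary incidence algebra $FI(X,K)$ of a poset $(X,\le)$ over a field $K$ is the $K$-space of formal sums $\alpha=\sum_{x\le y}\alpha_{xy}e_{xy}$ ($x,y\in X$, $\alpha_{xy}\in K$, $e_{xy}$ symbols) such that for all $x<y$ the set of pairs $(u,v)$ with $x\le u<v\le y$ and $\alpha_{uv}\neq 0$ is finite. The product is $\alpha\beta=\sum_{x\le y}\big(\sum_{x\le z\le y}\alpha_{xz}\beta_{zy}\big)e_{xy}$; it is a unital associative algebra with identity $\delta=\sum_{x\in X}e_{xx}$. Write $e_x=e_{xx}$ and, for $A\subseteq X$, $e_A=\sum_{x\in A}e_x$. Put $J(FI(X,K))=\{\alpha\in FI(X,K)\mid \alpha_{xx}=0\ \forall x\in X\}$ (this is the Jacobson radical). For $k\in K$, $L_k(\alpha)=\{x\in X\mid \alpha_{xx}=k\}$. For pairwise disjoint sets $B_k\subseteq X$ ($k\in K$), $\sum_{k\in K}k\,e_{B_k}$ denotes the element with zero off-diagonal coefficients whose $(x,x)$-coefficient is $k$ if $x\in B_k$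 and $0$ if $x$ lies in no $B_k$. A map $\varphi:A\to A$ on a unital associative algebra $A$ is an invertibility preserver of $A$ if $\varphi(U(A))\subseteq U(A)$, where $U(A)$ is the group of units; it is unital if $\varphi(1_A)=1_A$. Linear means $K$-linear. $\mathcal{P}(X)$ is the Boolean algebra of all subsets of $X$ under union, intersection and complement; endomorphisms of Boolean algebras preserve these operations and also $0=\emptyset$ and $1=X$. For a cardinal $\kappa$, an endomorphism $\lambda$ of $\mathcal{P}(X)$ is $\kappa$-complete if $\lambda(\bigcup_{i\in I}A_i)=\bigcup_{i\in I}\lambda(A_i)$ for every family $\{A_i\}_{i\in I}$ of subsets of $X$ with $|I|\le\kappa$. *)

theory Defs
  imports Complex_Main
begin

text \<open>
  A formal sum over pairs $x \le y$ is encoded as a coefficient function on all pairs that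
  vanishes outside the order relation.
\<close>

definition finitary :: "('a::order \<Rightarrow> 'a \<Rightarrow> 'k::zero) \<Rightarrow> bool" where
  "finitary f \<longleftrightarrow>
     (\<forall>x y. f x y \<noteq> 0 \<longrightarrow> x \<le> y) \<and>
     (\<forall>x y. x < y \<longrightarrow> finite {(u, v). x \<le> u \<and> u < v \<and> v \<le> y \<and> f u v \<noteq> 0})"

typedef (overloaded) ('a::order, 'k::field) fin_inc_alg =
  "{f :: 'a \<Rightarrow> 'a \<Rightarrow> 'k. finitary f}"
  morphisms coef Abs_fin_inc_alg
  by (rule exI[of _ "\<lambda>_ _. 0"]) (simp add: finitary_def)

setup_lifting type_definition_fin_inc_alg

lemma finitaryI_support:
  assumes "\<And>x y. h x y \<noteq> 0 \<Longrightarrow> x \<le> y"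
    and fin: "\<And>x y. x < y \<Longrightarrow> finite (S x y)"
    and sub: "\<And>x y u v. x \<le> u \<Longrightarrow> u < v \<Longrightarrow> v \<le> y \<Longrightarrow> h u v \<noteq> 0 \<Longrightarrow> (u, v) \<in> S x y"
  shows "finitary h"
  unfolding finitary_def
proof (intro conjI allI impI)
  fix x y :: 'a
  assume "x < y"
  show "finite {(u, v). x \<le> u \<and> u < v \<and> v \<le> y \<and> h u v \<noteq> 0}"
    by (rule finite_subset[OF _ fin[OF \<open>x < y\<close>]]) (clarify, rule sub)
qed (rule assms(1))

lemma finitary_le: "finitary f \<Longrightarrow> f x y \<noteq> 0 \<Longrightarrow> x \<le> y"
  by (auto simp: finitary_def)

lemma finitary_finite:
  "finitary f \<Longrightarrow> x < y \<Longrightarrow> finite {(u, v). x \<le> u \<and> u < v \<and> v \<le> y \<and> f u v \<noteq> 0}"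
  by (auto simp: finitary_def)

lemma finitary_add:
  fixes f g :: "'a::order \<Rightarrow> 'a \<Rightarrow> 'k::field"
  assumes f: "finitary f" and g: "finitary g"
  shows "finitary (\<lambda>x y. f x y + g x y)"
proof (rule finitaryI_support)
  show "x \<le> y" if "f x y + g x y \<noteq> 0" for x y
    using that finitary_le[OF f] finitary_le[OF g] by (metis add.left_neutral)
  show "finite ({(u, v). x \<le> u \<and> u < v \<and> v \<le> y \<and> f u v \<noteq> 0} \<union>
                {(u, v). x \<le> u \<and> u < v \<and> v \<le> y \<and> g u v \<noteq> 0})" if "x < y" for x y
    by (rule finite_UnI[OF finitary_finite[OF f that] finitary_finite[OF g that]])
qed auto

lemma finitary_smult:
  fixes f :: "'a::order \<Rightarrow> 'a \<Rightarrow> 'k::field"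
  assumes f: "finitary f"
  shows "finitary (\<lambda>x y. c * f x y)"
proof (rule finitaryI_support)
  show "x \<le> y" if "c * f x y \<noteq> 0" for x y
    using that finitary_le[OF f] by auto
  show "finite {(u, v). x \<le> u \<and> u < v \<and> v \<le> y \<and> f u v \<noteq> 0}" if "x < y" for x y
    by (rule finitary_finite[OF f that])
qed auto

text \<open>
  The interval $[x, y]$ may be infinite, and \<open>sum\<close> over an infinite set is 0, so the
  convolution sum is restricted to its nonzero terms, of which there are finitely many
  (see \<open>convolution_support_finite\<close>).
\<close>

definition convolution ::
  "('a::order \<Rightarrow> 'a \<Rightarrow> 'k::field) \<Rightarrow> ('a \<Rightarrow> 'a \<Rightarrow> 'k) \<Rightarrow> 'a \<Rightarrow> 'a \<Rightarrow> 'k" where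
  "convolution f g x y =
     (\<Sum>z | x \<le> z \<and> z \<le> y \<and> f x z * g z y \<noteq> 0. f x z * g z y)"

lemma convolution_support_finite:
  fixes f g :: "'a::order \<Rightarrow> 'a \<Rightarrow> 'k::field"
  assumes f: "finitary f"
  shows "finite {z. x \<le> z \<and> z \<le> y \<and> f x z * g z y \<noteq> 0}"
proof (cases "x < y")
  case True
  have "{z. x \<le> z \<and> z \<le> y \<and> f x z * g z y \<noteq> 0} \<subseteq>
      insert x (snd ` {(u, v). x \<le> u \<and> u < v \<and> v \<le> y \<and> f u v \<noteq> 0})"
    by (force simp: image_iff le_less)
  then show ?thesis
    using finitary_finite[OF f True] by (meson finite_imageI finite_insert finite_subset)
next
  case False
  then have "{z. x \<le> z \<and> z \<le> y \<and> f x z * g z y \<noteq> 0} \<subseteq> {x}"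
    by (auto simp: le_less)
  then show ?thesis
    using finite_subset by blast
qed

lemma convolution_eq_sum:
  fixes f g :: "'a::order \<Rightarrow> 'a \<Rightarrow> 'k::field"
  assumes f: "finitary f" and g: "finitary g" and S: "finite S"
    and sup: "\<And>z. f x z \<noteq> 0 \<Longrightarrow> g z y \<noteq> 0 \<Longrightarrow> z \<in> S"
  shows "convolution f g x y = (\<Sum>z\<in>S. f x z * g z y)"
  unfolding convolution_def
  by (rule sum.mono_neutral_left) (use S sup finitary_le[OF f] finitary_le[OF g] in auto)

lemma convolution_nonzero:
  assumes "convolution f g x y \<noteq> 0"
  obtains z where "x \<le> z" "z \<le> y" "f x z \<noteq> 0" "g z y \<noteq> 0"
  using sum.not_neutral_contains_not_neutral[OF assms[unfolded convolution_def]] by auto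

lemma finitary_convolution:
  fixes f g :: "'a::order \<Rightarrow> 'a \<Rightarrow> 'k::field"
  assumes f: "finitary f" and g: "finitary g"
  shows "finitary (convolution f g)"
proof -
  define F where "F = (\<lambda>x y. {(u, v). x \<le> u \<and> u < v \<and> v \<le> y \<and> f u v \<noteq> 0})"
  define G where "G = (\<lambda>x y. {(u, v). x \<le> u \<and> u < v \<and> v \<le> y \<and> g u v \<noteq> 0})"
  show ?thesis
  proof (rule finitaryI_support)
    show "x \<le> y" if "convolution f g x y \<noteq> 0" for x y
      using that by (elim convolution_nonzero) auto
    show "finite (F x y \<union> G x y \<union> fst ` F x y \<times> snd ` G x y)" if "x < y" for x y
    proof -
      have "finite (F x y)" unfolding F_def by (rule finitary_finite[OF f that])
      moreover have "finite (G x y)" unfolding G_def by (rule finitary_finite[OF g that])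
      ultimately show ?thesis by simp
    qed
    show "(u, v) \<in> F x y \<union> G x y \<union> fst ` F x y \<times> snd ` G x y"
      if uv: "x \<le> u" "u < v" "v \<le> y" and nz: "convolution f g u v \<noteq> 0" for x y u v
    proof -
      from nz obtain z where z: "u \<le> z" "z \<le> v" "f u z \<noteq> 0" "g z v \<noteq> 0"
        by (rule convolution_nonzero)
      consider "z = u" | "z = v" | "u < z" "z < v"
        using z by (auto simp: le_less)
      then show ?thesis
      proof cases
        case 3
        then have "(u, z) \<in> F x y" "(z, v) \<in> G x y"
          using uv z by (auto simp: F_def G_def intro: order.trans)
        then have "u \<in> fst ` F x y" "v \<in> snd ` G x y"
          by (metis fst_conv imageI, metis \<open>(z, v) \<in> G x y\<close> snd_conv imageI)
        then show ?thesis by blast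
      qed (use uv z in \<open>auto simp: F_def G_def\<close>)
    qed
  qed
qed

lemma convolution_assoc:
  fixes f g h :: "'a::order \<Rightarrow> 'a \<Rightarrow> 'k::field"
  assumes f: "finitary f" and g: "finitary g" and h: "finitary h"
  shows "convolution (convolution f g) h x y = convolution f (convolution g h) x y"
proof -
  define P where "P = (\<lambda>k :: 'a \<Rightarrow> 'a \<Rightarrow> 'k. {(u, v). x \<le> u \<and> u < v \<and> v \<le> y \<and> k u v \<noteq> 0})"
  define S where "S = {x, y} \<union> fst ` (P f \<union> P g \<union> P h) \<union> snd ` (P f \<union> P g \<union> P h)"
  have "finite (P k)" if "finitary k" for k
  proof (cases "x < y")
    case True
    then show ?thesis unfolding P_def by (rule finitary_finite[OF that])
  next
    case False
    then have "P k = {}"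
      unfolding P_def by (auto dest: order.strict_trans1 order.strict_trans2)
    then show ?thesis by simp
  qed
  then have S: "finite S"
    unfolding S_def using f g h by simp
  have mem: "u \<in> S \<and> v \<in> S"
    if "x \<le> u" "u < v" "v \<le> y" "f u v \<noteq> 0 \<or> g u v \<noteq> 0 \<or> h u v \<noteq> 0" for u v
  proof -
    have "(u, v) \<in> P f \<union> P g \<union> P h" using that by (auto simp: P_def)
    then show ?thesis unfolding S_def by force
  qed
  have fg: "convolution f g x w = (\<Sum>z\<in>S. f x z * g z w)" if "w \<le> y" for w
  proof (rule convolution_eq_sum[OF f g S])
    fix z assume z: "f x z \<noteq> 0" "g z w \<noteq> 0"
    then have le: "x \<le> z" "z \<le> w" using finitary_le[OF f] finitary_le[OF g] by auto
    show "z \<in> S"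
    proof (cases "x = z")
      case True then show ?thesis by (simp add: S_def)
    next
      case False
      then have "x < z" "z \<le> y" using le that by auto
      then show ?thesis using mem[of x z] z by blast
    qed
  qed
  have gh: "convolution g h z y = (\<Sum>w\<in>S. g z w * h w y)" if "x \<le> z" for z
  proof (rule convolution_eq_sum[OF g h S])
    fix w assume w: "g z w \<noteq> 0" "h w y \<noteq> 0"
    then have le: "z \<le> w" "w \<le> y" using finitary_le[OF g] finitary_le[OF h] by auto
    show "w \<in> S"
    proof (cases "w = y")
      case True then show ?thesis by (simp add: S_def)
    next
      case False
      then have "w < y" "x \<le> w" using le that by auto
      then show ?thesis using mem[of w y] w by blast
    qed
  qed
  have "convolution (convolution f g) h x y = (\<Sum>w\<in>S. convolution f g x w * h w y)"
  proof (rule convolution_eq_sum[OF finitary_convolution[OF f g] h S])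
    fix w assume w: "convolution f g x w \<noteq> 0" "h w y \<noteq> 0"
    then have le: "x \<le> w" "w \<le> y"
      using finitary_le[OF finitary_convolution[OF f g]] finitary_le[OF h] by auto
    show "w \<in> S"
    proof (cases "w = y")
      case True then show ?thesis by (simp add: S_def)
    next
      case False
      then have "w < y" "x \<le> w" using le by auto
      then show ?thesis using mem[of w y] w by blast
    qed
  qed
  also have "\<dots> = (\<Sum>w\<in>S. (\<Sum>z\<in>S. f x z * g z w) * h w y)"
  proof (rule sum.cong[OF refl])
    fix w
    show "convolution f g x w * h w y = (\<Sum>z\<in>S. f x z * g z w) * h w y"
      using fg[of w] finitary_le[OF h, of w y] by (cases "h w y = 0") simp_all
  qed
  also have "\<dots> = (\<Sum>z\<in>S. f x z * (\<Sum>w\<in>S. g z w * h w y))"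
    unfolding sum_distrib_left sum_distrib_right
    by (subst sum.swap) (simp add: mult.assoc)
  also have "\<dots> = (\<Sum>z\<in>S. f x z * convolution g h z y)"
  proof (rule sum.cong[OF refl])
    fix z
    show "f x z * (\<Sum>w\<in>S. g z w * h w y) = f x z * convolution g h z y"
      using gh[of z] finitary_le[OF f, of x z] by (cases "f x z = 0") simp_all
  qed
  also have "\<dots> = convolution f (convolution g h) x y"
  proof (rule convolution_eq_sum[OF f finitary_convolution[OF g h] S, symmetric])
    fix z assume z: "f x z \<noteq> 0" "convolution g h z y \<noteq> 0"
    then have le: "x \<le> z" "z \<le> y"
      using finitary_le[OF finitary_convolution[OF g h]] finitary_le[OF f] by auto
    show "z \<in> S"
    proof (cases "x = z")
      case True then show ?thesis by (simp add: S_def)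
    next
      case False
      then have "x < z" "z \<le> y" using le by auto
      then show ?thesis using mem[of x z] z by blast
    qed
  qed
  finally show ?thesis .
qed

lemma convolution_add_left:
  fixes f g h :: "'a::order \<Rightarrow> 'a \<Rightarrow> 'k::field"
  assumes f: "finitary f" and g: "finitary g" and h: "finitary h"
  shows "convolution (\<lambda>x y. f x y + g x y) h x y = convolution f h x y + convolution g h x y"
proof -
  define S where "S = {z. x \<le> z \<and> z \<le> y \<and> f x z * h z y \<noteq> 0} \<union>
    {z. x \<le> z \<and> z \<le> y \<and> g x z * h z y \<noteq> 0}"
  have S: "finite S"
    unfolding S_def using convolution_support_finite[OF f] convolution_support_finite[OF g] by (intro finite_UnI)
  have mem: "z \<in> S" if "f x z \<noteq> 0 \<or> g x z \<noteq> 0" "h z y \<noteq> 0" for z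
    using that finitary_le[OF f, of x z] finitary_le[OF g, of x z] finitary_le[OF h, of z y]
    by (auto simp: S_def)
  have "convolution (\<lambda>x y. f x y + g x y) h x y = (\<Sum>z\<in>S. (f x z + g x z) * h z y)"
    by (rule convolution_eq_sum[OF finitary_add[OF f g] h S]) (rule mem; auto)
  moreover have "convolution f h x y = (\<Sum>z\<in>S. f x z * h z y)"
    by (rule convolution_eq_sum[OF f h S]) (rule mem; auto)
  moreover have "convolution g h x y = (\<Sum>z\<in>S. g x z * h z y)"
    by (rule convolution_eq_sum[OF g h S]) (rule mem; auto)
  ultimately show ?thesis
    by (simp add: sum.distrib distrib_right)
qed

lemma convolution_add_right:
  fixes f g h :: "'a::order \<Rightarrow> 'a \<Rightarrow> 'k::field"
  assumes f: "finitary f" and g: "finitary g" and h: "finitary h"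
  shows "convolution h (\<lambda>x y. f x y + g x y) x y = convolution h f x y + convolution h g x y"
proof -
  define S where "S = {z. x \<le> z \<and> z \<le> y \<and> h x z * f z y \<noteq> 0} \<union>
    {z. x \<le> z \<and> z \<le> y \<and> h x z * g z y \<noteq> 0}"
  have S: "finite S"
    unfolding S_def using convolution_support_finite[OF h] by (intro finite_UnI)
  have mem: "z \<in> S" if "f z y \<noteq> 0 \<or> g z y \<noteq> 0" "h x z \<noteq> 0" for z
    using that finitary_le[OF f, of z y] finitary_le[OF g, of z y] finitary_le[OF h, of x z]
    by (auto simp: S_def)
  have "convolution h (\<lambda>x y. f x y + g x y) x y = (\<Sum>z\<in>S. h x z * (f z y + g z y))"
    by (rule convolution_eq_sum[OF h finitary_add[OF f g] S]) (rule mem; auto)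
  moreover have "convolution h f x y = (\<Sum>z\<in>S. h x z * f z y)"
    by (rule convolution_eq_sum[OF h f S]) (rule mem; auto)
  moreover have "convolution h g x y = (\<Sum>z\<in>S. h x z * g z y)"
    by (rule convolution_eq_sum[OF h g S]) (rule mem; auto)
  ultimately show ?thesis
    by (simp add: sum.distrib distrib_left)
qed

lemma finitary_diag: "finitary (\<lambda>x y. if x = y then d x else 0)"
  by (rule finitaryI_support[where S = "\<lambda>_ _. {}"]) (auto split: if_splits)

lemma convolution_one_left:
  fixes f :: "'a::order \<Rightarrow> 'a \<Rightarrow> 'k::field"
  assumes "finitary f"
  shows "convolution (\<lambda>x y. if x = y then 1 else 0) f x y = f x y"
  by (subst convolution_eq_sum[OF finitary_diag assms, of "{x}"]) (auto split: if_splits)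

lemma convolution_one_right:
  fixes f :: "'a::order \<Rightarrow> 'a \<Rightarrow> 'k::field"
  assumes "finitary f"
  shows "convolution f (\<lambda>x y. if x = y then 1 else 0) x y = f x y"
  by (subst convolution_eq_sum[OF assms finitary_diag, of "{y}"]) (auto split: if_splits)

instantiation fin_inc_alg :: (order, field) ring_1
begin

lift_definition zero_fin_inc_alg :: "('a, 'b) fin_inc_alg" is "\<lambda>_ _. 0"
  by (simp add: finitary_def)

lift_definition one_fin_inc_alg :: "('a, 'b) fin_inc_alg" is "\<lambda>x y. if x = y then 1 else 0"
  by (rule finitary_diag)

lift_definition plus_fin_inc_alg ::
  "('a, 'b) fin_inc_alg \<Rightarrow> ('a, 'b) fin_inc_alg \<Rightarrow> ('a, 'b) fin_inc_alg"
  is "\<lambda>f g x y. f x y + g x y"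
  by (rule finitary_add)

lift_definition uminus_fin_inc_alg :: "('a, 'b) fin_inc_alg \<Rightarrow> ('a, 'b) fin_inc_alg"
  is "\<lambda>f x y. - f x y"
  using finitary_smult[of _ "-1"] by simp

lift_definition minus_fin_inc_alg ::
  "('a, 'b) fin_inc_alg \<Rightarrow> ('a, 'b) fin_inc_alg \<Rightarrow> ('a, 'b) fin_inc_alg"
  is "\<lambda>f g x y. f x y - g x y"
  using finitary_add[OF _ finitary_smult[of _ "-1"]] by simp

lift_definition times_fin_inc_alg ::
  "('a, 'b) fin_inc_alg \<Rightarrow> ('a, 'b) fin_inc_alg \<Rightarrow> ('a, 'b) fin_inc_alg"
  is convolution
  by (rule finitary_convolution)

instance
proof
  fix a b c :: "('a, 'b) fin_inc_alg"
  show "a * b * c = a * (b * c)"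
    by transfer (intro ext convolution_assoc; assumption)
  show "1 * a = a"
    by transfer (intro ext convolution_one_left; assumption)
  show "a * 1 = a"
    by transfer (intro ext convolution_one_right; assumption)
  show "(a + b) * c = a * c + b * c"
    by transfer (intro ext convolution_add_left; assumption)
  show "a * (b + c) = a * b + a * c"
    by transfer (intro ext convolution_add_right; assumption)
  show "(0 :: ('a, 'b) fin_inc_alg) \<noteq> 1"
    by transfer (metis zero_neq_one)
qed (transfer; auto simp: fun_eq_iff add.assoc add.commute)+

end

lift_definition scale_fi ::
  "'k::field \<Rightarrow> ('a::order, 'k) fin_inc_alg \<Rightarrow> ('a, 'k) fin_inc_alg"
  is "\<lambda>c f x y. c * f x y"
  by (rule finitary_smult)

global_interpretation fin_inc_alg: vector_space
  "scale_fi :: 'k::field \<Rightarrow> ('a::order, 'k) fin_inc_alg \<Rightarrow> ('a, 'k) fin_inc_alg"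
  by unfold_locales (transfer; simp add: fun_eq_iff algebra_simps)+

definition rad_fi :: "('a::order, 'k::field) fin_inc_alg set" where
  "rad_fi = {\<alpha>. \<forall>x. coef \<alpha> x x = 0}"

definition level_set :: "'k::field \<Rightarrow> ('a::order, 'k) fin_inc_alg \<Rightarrow> 'a set" where
  "level_set k \<alpha> = {x. coef \<alpha> x x = k}"

text \<open>
  The element $\sum_{k \in K} k\, e_{B_k}$. It is meaningful for pairwise disjoint families
  \<open>B\<close> only, for which the description below is unique.
\<close>

lift_definition sum_idem ::
  "('k::field \<Rightarrow> 'a::order set) \<Rightarrow> ('a, 'k) fin_inc_alg"
  is "\<lambda>B x y. if x = y then (if \<exists>k. x \<in> B k then THE k. x \<in> B k else 0) else 0"
  by (rule finitary_diag)

lemma coef_sum_idem: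
  assumes disj: "\<And>i j. i \<noteq> j \<Longrightarrow> B i \<inter> B j = {}" and x: "x \<in> B k"
  shows "coef (sum_idem B) x x = k"
proof -
  have "(THE k. x \<in> B k) = k"
    using disj x by (intro the_equality) blast+
  with x show ?thesis
    by (auto simp: sum_idem.rep_eq)
qed

definition unit_elems :: "'r::monoid_mult set" where
  "unit_elems = {a. \<exists>b. a * b = 1 \<and> b * a = 1}"

definition invertibility_preserver :: "('r::monoid_mult \<Rightarrow> 'r) \<Rightarrow> bool" where
  "invertibility_preserver \<phi> \<longleftrightarrow> \<phi> ` unit_elems \<subseteq> unit_elems"

definition unital :: "('r::monoid_mult \<Rightarrow> 'r) \<Rightarrow> bool" where
  "unital \<phi> \<longleftrightarrow> \<phi> 1 = 1"

definition boolean_endo :: "('a set \<Rightarrow> 'a set) \<Rightarrow> bool" where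
  "boolean_endo l \<longleftrightarrow>
     (\<forall>A B. l (A \<union> B) = l A \<union> l B) \<and> (\<forall>A B. l (A \<inter> B) = l A \<inter> l B) \<and>
     (\<forall>A. l (- A) = - l A) \<and> l {} = {} \<and> l UNIV = UNIV"

unbundle cardinal_syntax

text \<open>
  For a cardinal \<open>\<kappa>\<close> living on the type \<open>'c\<close>, every index set of cardinality at most \<open>\<kappa>\<close>
  is in bijection with a subset of \<open>'c\<close>, so indexing families by subsets of \<open>'c\<close> loses nothing;
  \<open>complete_endo_UN\<close> gives the law for an arbitrary index type.
\<close>

definition complete_endo :: "'c rel \<Rightarrow> ('a set \<Rightarrow> 'a set) \<Rightarrow> bool" where
  "complete_endo \<kappa> l \<longleftrightarrow> boolean_endo l \<and>
     (\<forall>(I :: 'c set) A. |I| \<le>o \<kappa> \<longrightarrow> l (\<Union>i\<in>I. A i) = (\<Union>i\<in>I. l (A i)))"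

lemma complete_endo_UN:
  fixes \<kappa> :: "'c rel" and J :: "'j set"
  assumes \<kappa>: "Card_order \<kappa>" and l: "complete_endo \<kappa> l" and J: "|J| \<le>o \<kappa>"
  shows "l (\<Union>j\<in>J. A j) = (\<Union>j\<in>J. l (A j))"
proof -
  have "|J| \<le>o |Field \<kappa>|"
    by (rule ordLeq_ordIso_trans[OF J ordIso_symmetric[OF card_of_Field_ordIso[OF \<kappa>]]])
  then obtain f where f: "inj_on f J" "f ` J \<subseteq> Field \<kappa>"
    unfolding card_of_ordLeq[symmetric] by blast
  have "|f ` J| \<le>o \<kappa>"
    by (rule ordLeq_transitive[OF card_of_image J])
  then have "l (\<Union>i\<in>f ` J. A (inv_into J f i)) = (\<Union>i\<in>f ` J. l (A (inv_into J f i)))"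
    using l[unfolded complete_endo_def, THEN conjunct2, rule_format,
        of "f ` J" "\<lambda>i. A (inv_into J f i)"] by simp
  then show ?thesis
    using f by simp
qed

end

theory Submission
  imports Defs
begin

text \<open>
  An element is a unit iff its diagonal has no zero: an element of the radical is locally
  nilpotent, so $1 - \rho$ is inverted by a geometric series that is finite at each entry.

  Given a unital linear invertibility preserver $\varphi$ and a point $x$, the functional
  $f(\alpha) = \varphi(\alpha)_{xx}$ does not vanish on units. Hence it kills the radical, and
  $f(\alpha)$ is always one of the diagonal values of $\alpha$, because
  $\alpha - f(\alpha)$ is in the kernel of $f$. In particular $f(e_A) \in \{0, 1\}$, and for
  $|K| > 2$ the sets $A$ with $f(e_A) = 1$ form an ultrafilter. It contains $L_k(\alpha)$ for
  $k = f(\alpha)$: otherwise $\alpha - k + e_{L_k(\alpha)}$ would be a unit in the kernel of $f$.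
  So $\lambda(A)$ is the set of the points $x$ whose ultrafilter contains $A$.
\<close>

section \<open>Coefficients, locality of the product, and diagonal elements\<close>

lemma coef_zero [simp]: "coef 0 x y = 0"
  by transfer simp

lemma coef_one: "coef 1 x y = (if x = y then 1 else 0)"
  by transfer simp

lemma coef_add [simp]: "coef (a + b) x y = coef a x y + coef b x y"
  by transfer simp

lemma coef_diff [simp]: "coef (a - b) x y = coef a x y - coef b x y"
  by transfer simp

lemma coef_scale [simp]: "coef (scale_fi c a) x y = c * coef a x y"
  by transfer simp

lemma coef_sum: "coef (\<Sum>i\<in>S. a i) x y = (\<Sum>i\<in>S. coef (a i) x y)"
  by (induction S rule: infinite_finite_induct) simp_all

lemma coef_times: "coef (a * b) = convolution (coef a) (coef b)"
  by transfer simp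

lemma finitary_coef: "finitary (coef a)"
  using coef by blast

lemma coef_eq_0: "\<not> x \<le> y \<Longrightarrow> coef a x y = 0"
  using finitary_le[OF finitary_coef] by blast

lemma fin_inc_alg_eqI: "(\<And>x y. coef a x y = coef b x y) \<Longrightarrow> a = b"
  by transfer (simp add: fun_eq_iff)

lemma coef_times_diag: "coef (a * b) x x = coef a x x * coef b x x"
proof -
  have "convolution (coef a) (coef b) x x = (\<Sum>z\<in>{x}. coef a x z * coef b z x)"
    by (rule convolution_eq_sum[OF finitary_coef finitary_coef])
       (auto dest!: finitary_le[OF finitary_coef])
  then show ?thesis by (simp add: coef_times)
qed

lemma coef_times_nonzero:
  assumes "coef (a * b) x y \<noteq> 0"
  obtains z where "x \<le> z" "z \<le> y" "coef a x z \<noteq> 0" "coef b z y \<noteq> 0"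
  using assms unfolding coef_times by (rule convolution_nonzero)

text \<open>Locality of the product: only entries inside the interval from \<open>x\<close> to
  \<open>y\<close> matter. This lets a truncated series replace an infinite one when a single entry
  is computed.\<close>

lemma coef_times_cong:
  assumes "\<And>z. x \<le> z \<Longrightarrow> z \<le> y \<Longrightarrow> coef a x z = coef a' x z"
    and "\<And>z. x \<le> z \<Longrightarrow> z \<le> y \<Longrightarrow> coef b z y = coef b' z y"
  shows "coef (a * b) x y = coef (a' * b') x y"
  unfolding coef_times convolution_def by (rule sum.cong) (use assms in auto)

lift_definition diag_fi :: "('a::order \<Rightarrow> 'k::field) \<Rightarrow> ('a, 'k) fin_inc_alg"
  is "\<lambda>d x y. if x = y then d x else 0"
  by (rule finitary_diag)

lemma coef_diag: "coef (diag_fi d) x y = (if x = y then d x else 0)"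
  by transfer simp

lemma diag_fi_times: "diag_fi c * diag_fi d = diag_fi (\<lambda>x. c x * d x)"
proof (rule fin_inc_alg_eqI)
  fix x y :: 'a
  show "coef (diag_fi c * diag_fi d) x y = coef (diag_fi (\<lambda>x. c x * d x)) x y"
  proof (cases "x = y")
    case True
    then show ?thesis by (simp add: coef_times_diag coef_diag)
  next
    case False
    then have "coef (diag_fi c * diag_fi d) x y = 0"
      by (rule_tac ccontr, elim coef_times_nonzero) (auto simp: coef_diag split: if_splits)
    then show ?thesis using False by (simp add: coef_diag)
  qed
qed

lemma diag_fi_one: "diag_fi (\<lambda>_. 1) = 1"
  by (rule fin_inc_alg_eqI) (simp add: coef_diag coef_one)

section \<open>Local nilpotency of the radical and the description of units\<close>

definition seg_support :: "('a::order, 'k::field) fin_inc_alg \<Rightarrow> 'a \<Rightarrow> 'a \<Rightarrow> ('a \<times> 'a) set" where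
  "seg_support a x y = {(u, v). x \<le> u \<and> u < v \<and> v \<le> y \<and> coef a u v \<noteq> 0}"

lemma finite_seg_support: "finite (seg_support a x y)"
proof (cases "x < y")
  case True
  then show ?thesis
    unfolding seg_support_def by (rule finitary_finite[OF finitary_coef])
next
  case False
  then have "seg_support a x y = {}"
    unfolding seg_support_def by (auto dest: order.strict_trans1 order.strict_trans2)
  then show ?thesis by simp
qed

lemma rad_coef_nonzero_less: "r \<in> rad_fi \<Longrightarrow> coef r x y \<noteq> 0 \<Longrightarrow> x < y"
  unfolding rad_fi_def using coef_eq_0[of x y r] by (auto simp: le_less)

text \<open>A nonzero entry of \<open>r ^ n\<close> comes from a strict chain of \<open>n\<close>
  steps from \<open>x\<close> to \<open>y\<close>. Peeling off the first step, from \<open>x\<close>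
  to \<open>z\<close>, removes at least the pair \<open>(x, z)\<close> from the finite support, so
  its cardinality bounds the length of the chain.\<close>

lemma coef_rad_power_nonzero:
  assumes r: "r \<in> rad_fi" and nz: "coef (r ^ n) x y \<noteq> 0"
  shows "n \<le> card (seg_support r x y)"
  using nz
proof (induction n arbitrary: x)
  case (Suc n)
  then obtain z where z: "x \<le> z" "z \<le> y" "coef r x z \<noteq> 0" "coef (r ^ n) z y \<noteq> 0"
    by (auto elim: coef_times_nonzero)
  then have "x < z"
    using rad_coef_nonzero_less[OF r] by blast
  then have "seg_support r z y \<subset> seg_support r x y"
    using z unfolding seg_support_def by (auto simp: less_le_not_le intro: order.trans)
  then have "card (seg_support r z y) < card (seg_support r x y)"
    by (rule psubset_card_mono[OF finite_seg_support])
  with Suc.IH[OF z(4)] show ?case by simp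
qed simp

text \<open>Here \<open>r\<close> may have diagonal entries, so a chain may also stay in place.
  Since \<open>x \<noteq> y\<close>, some step is strict; the first strict step starts at
  \<open>x\<close> and the last one ends at \<open>y\<close>.\<close>

lemma coef_power_nonzero_ends:
  assumes nz: "coef (r ^ n) x y \<noteq> 0" and "x \<noteq> y"
  shows "x \<in> fst ` seg_support r x y" "y \<in> snd ` seg_support r x y"
proof -
  have "x \<in> fst ` seg_support r x y \<and> y \<in> snd ` seg_support r x y"
    using assms
  proof (induction n arbitrary: x)
    case 0
    then show ?case by (simp add: coef_one)
  next
    case (Suc n)
    then obtain z where z: "x \<le> z" "z \<le> y" "coef r x z \<noteq> 0" "coef (r ^ n) z y \<noteq> 0"
      by (auto elim: coef_times_nonzero)
    have mono: "seg_support r z y \<subseteq> seg_support r x y"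
      unfolding seg_support_def using z(1) by auto
    consider "z = x" | "z = y" | "x < z" "z \<noteq> y"
      using z by (auto simp: le_less)
    then show ?case
    proof cases
      case 1
      then show ?thesis using Suc z by blast
    next
      case 2
      then have "(x, y) \<in> seg_support r x y"
        using z Suc.prems(2) unfolding seg_support_def by auto
      then show ?thesis by force
    next
      case 3
      then have "(x, z) \<in> seg_support r x y"
        using z unfolding seg_support_def by auto
      moreover have "y \<in> snd ` seg_support r z y"
        using Suc.IH[OF z(4) 3(2)] by blast
      ultimately show ?thesis using mono by force
    qed
  qed
  then show "x \<in> fst ` seg_support r x y" "y \<in> snd ` seg_support r x y" by auto
qed

lemma seg_support_mono: "x \<le> u \<Longrightarrow> v \<le> y \<Longrightarrow> seg_support a u v \<subseteq> seg_support a x y"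
  unfolding seg_support_def by (auto intro: order.trans)

text \<open>The series of all powers of \<open>r\<close>, cut off entry by entry. For
  \<open>r\<close> in the radical the cutoff loses nothing, by
  \<open>coef_rad_power_nonzero\<close>; it also makes the formula meaningful for every
  \<open>r\<close>, as lifting requires.\<close>

lift_definition geometric_fi :: "('a::order, 'k::field) fin_inc_alg \<Rightarrow> ('a, 'k) fin_inc_alg"
  is "\<lambda>r x y. \<Sum>n\<le>card (seg_support r x y). coef (r ^ n) x y"
proof (rule finitaryI_support)
  fix r :: "('a, 'k) fin_inc_alg" and x y u v :: 'a
  show "x \<le> y" if "(\<Sum>n\<le>card (seg_support r x y). coef (r ^ n) x y) \<noteq> 0"
    using sum.not_neutral_contains_not_neutral[OF that] coef_eq_0 by blast
  \<comment> \<open>By \<open>coef_power_nonzero_ends\<close>, all off-diagonal support in the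
    interval lies in this product of starting points and end points.\<close>
  show "finite (fst ` seg_support r x y \<times> snd ` seg_support r x y)"
    by (intro finite_cartesian_product finite_imageI finite_seg_support)
  show "(u, v) \<in> fst ` seg_support r x y \<times> snd ` seg_support r x y"
    if "x \<le> u" "u < v" "v \<le> y"
      and nz: "(\<Sum>n\<le>card (seg_support r u v). coef (r ^ n) u v) \<noteq> 0"
  proof -
    obtain n where "coef (r ^ n) u v \<noteq> 0"
      using sum.not_neutral_contains_not_neutral[OF nz] by blast
    then have "u \<in> fst ` seg_support r u v" "v \<in> snd ` seg_support r u v"
      using coef_power_nonzero_ends[of r n u v] \<open>u < v\<close> by auto
    then show ?thesis
      using seg_support_mono[OF \<open>x \<le> u\<close> \<open>v \<le> y\<close>, of r] by blast
  qed
qed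

lemma coef_geometric:
  assumes r: "r \<in> rad_fi" and N: "card (seg_support r x y) \<le> N"
  shows "coef (geometric_fi r) x y = coef (\<Sum>n\<le>N. r ^ n) x y"
proof -
  have "coef (geometric_fi r) x y = (\<Sum>n\<le>card (seg_support r x y). coef (r ^ n) x y)"
    by transfer simp
  also have "\<dots> = (\<Sum>n\<le>N. coef (r ^ n) x y)"
    by (rule sum.mono_neutral_left) (use N coef_rad_power_nonzero[OF r] in auto)
  finally show ?thesis by (simp add: coef_sum)
qed

lemma geometric_sum_times:
  fixes r :: "'r::ring_1"
  shows "(1 - r) * (\<Sum>n\<le>N. r ^ n) = 1 - r ^ Suc N"
    and "(\<Sum>n\<le>N. r ^ n) * (1 - r) = 1 - r ^ Suc N"
proof (induction N)
  case (Suc N)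
  have "(1 - r) * (\<Sum>n\<le>Suc N. r ^ n) = (1 - r) * (\<Sum>n\<le>N. r ^ n) + (1 - r) * r ^ Suc N"
    by (simp add: distrib_left)
  also have "\<dots> = 1 - r ^ Suc (Suc N)"
    unfolding Suc by (simp add: left_diff_distrib)
  finally show "(1 - r) * (\<Sum>n\<le>Suc N. r ^ n) = 1 - r ^ Suc (Suc N)" .
  have "(\<Sum>n\<le>Suc N. r ^ n) * (1 - r) = (\<Sum>n\<le>N. r ^ n) * (1 - r) + r ^ Suc N * (1 - r)"
    by (simp add: distrib_right)
  also have "\<dots> = 1 - r ^ Suc (Suc N)"
    unfolding Suc by (simp add: right_diff_distrib power_commutes mult.assoc)
  finally show "(\<Sum>n\<le>Suc N. r ^ n) * (1 - r) = 1 - r ^ Suc (Suc N)" .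
qed simp_all

text \<open>At a fixed entry, locality replaces the series by one finite geometric sum, whose
  product with \<open>1 - r\<close> telescopes to \<open>1 - r ^ Suc N\<close>; the remaining power
  vanishes at that entry.\<close>

lemma one_minus_rad_unit:
  assumes r: "r \<in> rad_fi"
  shows "1 - r \<in> unit_elems"
proof -
  have coef_eq: "coef ((1 - r) * geometric_fi r) x y = coef 1 x y \<and>
    coef (geometric_fi r * (1 - r)) x y = coef 1 x y" for x y
  proof -
    \<comment> \<open>Supports of subintervals are smaller, so this single cutoff is valid for every
      entry that the product at \<open>(x, y)\<close> uses.\<close>
    define N where "N = card (seg_support r x y)"
    define G where "G = (\<Sum>n\<le>N. r ^ n)"
    have G: "coef (geometric_fi r) u v = coef G u v" if "x \<le> u" "v \<le> y" for u v
      unfolding G_def N_def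
      by (rule coef_geometric[OF r card_mono[OF finite_seg_support seg_support_mono]]) fact+
    have tele: "(1 - r) * G = 1 - r ^ Suc N" "G * (1 - r) = 1 - r ^ Suc N"
      unfolding G_def by (rule geometric_sum_times)+
    have "coef (r ^ Suc N) x y = 0"
      using coef_rad_power_nonzero[OF r, of "Suc N" x y] unfolding N_def by linarith
    then have "coef ((1 - r) * G) x y = coef 1 x y" "coef (G * (1 - r)) x y = coef 1 x y"
      unfolding tele by simp_all
    then show ?thesis
      using coef_times_cong[of x y "1 - r" "1 - r" "geometric_fi r" G]
        coef_times_cong[of x y "geometric_fi r" G "1 - r" "1 - r"] G by simp
  qed
  then have "(1 - r) * geometric_fi r = 1" "geometric_fi r * (1 - r) = 1"
    by (blast intro: fin_inc_alg_eqI)+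
  then show ?thesis unfolding unit_elems_def by blast
qed

lemma unit_elems_mult:
  assumes "a \<in> unit_elems" "b \<in> unit_elems"
  shows "a * b \<in> unit_elems"
proof -
  obtain a' b' where "a * a' = 1" "a' * a = 1" "b * b' = 1" "b' * b = 1"
    using assms unfolding unit_elems_def by auto
  then have "(a * b) * (b' * a') = 1" "(b' * a') * (a * b) = 1"
    by (metis mult.assoc mult.right_neutral)+
  then show ?thesis unfolding unit_elems_def by blast
qed

text \<open>Units have nonzero diagonal because taking a diagonal entry is multiplicative.
  Conversely, dividing by the invertible diagonal part \<open>D\<close> leaves an element with
  diagonal 1, which is 1 minus an element of the radical.\<close>

lemma unit_iff_diag_nonzero:
  fixes a :: "('a::order, 'k::field) fin_inc_alg"
  shows "a \<in> unit_elems \<longleftrightarrow> (\<forall>x. coef a x x \<noteq> 0)"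
proof
  assume "a \<in> unit_elems"
  then obtain b where "a * b = 1"
    unfolding unit_elems_def by auto
  then have "coef a x x * coef b x x = 1" for x
    by (metis coef_times_diag coef_one)
  then show "\<forall>x. coef a x x \<noteq> 0"
    by (metis mult_zero_left zero_neq_one)
next
  assume nz: "\<forall>x. coef a x x \<noteq> 0"
  define d where "d = (\<lambda>x. coef a x x)"
  define D where "D = diag_fi d"
  define D' where "D' = diag_fi (\<lambda>x. inverse (d x))"
  have inv: "D * D' = 1" "D' * D = 1"
    using nz unfolding D_def D'_def d_def diag_fi_times by (simp_all add: diag_fi_one)
  have "1 - D' * a \<in> rad_fi"
    using nz unfolding rad_fi_def D'_def d_def
    by (simp add: coef_times_diag coef_diag coef_one)
  then have "D' * a \<in> unit_elems"
    using one_minus_rad_unit by fastforce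
  moreover have "D \<in> unit_elems"
    using inv unfolding unit_elems_def by blast
  ultimately have "D * (D' * a) \<in> unit_elems"
    by (rule unit_elems_mult[rotated])
  then show "a \<in> unit_elems"
    using inv by (simp flip: mult.assoc)
qed

section \<open>Functionals that do not vanish on units, and their ultrafilters\<close>

definition idem_fi :: "'a::order set \<Rightarrow> ('a, 'k::field) fin_inc_alg" where
  "idem_fi A = diag_fi (\<lambda>x. if x \<in> A then 1 else 0)"

lemma coef_idem: "coef (idem_fi A) x y = (if x = y \<and> x \<in> A then 1 else 0)"
  by (simp add: idem_fi_def coef_diag)

lemma idem_fi_UNIV: "idem_fi UNIV = 1"
  by (simp add: idem_fi_def diag_fi_one)

lemma idem_fi_Un: "A \<inter> B = {} \<Longrightarrow> idem_fi (A \<union> B) = idem_fi A + idem_fi B"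
  by (rule fin_inc_alg_eqI) (auto simp: coef_idem)

text \<open>Abstracts one diagonal entry of \<phi>: the theorem uses it at each point
  \<open>x\<close> with \<open>f a = coef (\<phi> a) x x\<close>.\<close>

locale unital_functional =
  fixes f :: "('a::order, 'k::field) fin_inc_alg \<Rightarrow> 'k"
  assumes add: "f (a + b) = f a + f b"
    and scale: "f (scale_fi c a) = c * f a"
    and one: "f 1 = 1"
    and unit_nonzero: "a \<in> unit_elems \<Longrightarrow> f a \<noteq> 0"
begin

lemma diff: "f (a - b) = f a - f b"
  by (metis add add_diff_cancel_right' diff_add_cancel)

text \<open>By \<open>unit_iff_diag_nonzero\<close> the diagonal values of \<open>a\<close> are its
  spectrum, so this is an algebraic form of the Gleason-Kahane-Zelazko principle.\<close>

lemma obtain_value: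
  obtains x where "coef a x x = f a"
proof -
  have "f (a - scale_fi (f a) 1) = 0"
    by (simp add: diff scale one)
  then have "a - scale_fi (f a) 1 \<notin> unit_elems"
    using unit_nonzero by blast
  then show thesis
    using that by (auto simp: unit_iff_diag_nonzero coef_one)
qed

definition large :: "'a set \<Rightarrow> bool" where
  "large A \<longleftrightarrow> f (idem_fi A) = 1"

lemma idem_value: "f (idem_fi A) = (if large A then 1 else 0)"
  by (rule obtain_value[of "idem_fi A"]) (auto simp: coef_idem large_def split: if_splits)

lemma not_large_empty: "\<not> large {}"
  by (rule obtain_value[of "idem_fi {}"]) (simp add: large_def coef_idem)

lemma large_UNIV: "large UNIV"
  by (simp add: large_def idem_fi_UNIV one)

lemma large_Compl: "large (- A) \<longleftrightarrow> \<not> large A"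
proof -
  have "f (idem_fi A) + f (idem_fi (- A)) = 1"
    using idem_fi_Un[of A "- A"] large_UNIV add by (metis Compl_disjoint Compl_partition large_def)
  then show ?thesis
    by (simp add: idem_value split: if_splits)
qed

text \<open>\<open>card\<close> is 0 on an infinite type, hence the separate case for infinite
  fields.\<close>

context
  assumes K: "infinite (UNIV :: 'k set) \<or> card (UNIV :: 'k set) > 2"
begin

lemma obtain_scalar:
  obtains k :: 'k where "k \<noteq> 0" "k \<noteq> 1"
proof -
  have "UNIV \<noteq> {0, 1 :: 'k}"
    using K by (metis card_2_iff finite.emptyI finite.insertI less_irrefl zero_neq_one)
  then show thesis using that by blast
qed

text \<open>A scalar \<open>k\<close> other than 0 and 1 forces \<open>1 + k = 0\<close>, while the
  scalar 1 forces characteristic 2; together they give \<open>k = 1\<close>. Over the field with two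
  elements this fails: the sum of three distinct diagonal entries is 1 on every unit, yet makes
  three disjoint singletons large.\<close>

lemma large_disjoint:
  assumes "A \<inter> B = {}" "large A" "large B"
  shows False
proof -
  have vals: "1 + k \<in> {0, 1, k}" for k :: 'k
  proof -
    have "f (idem_fi A + scale_fi k (idem_fi B)) = 1 + k"
      using assms by (simp add: add scale large_def)
    then show ?thesis
      using assms(1)
      by (rule_tac obtain_value[of "idem_fi A + scale_fi k (idem_fi B)"])
         (auto simp: coef_idem split: if_splits)
  qed
  obtain k :: 'k where "k \<noteq> 0" "k \<noteq> 1"
    by (rule obtain_scalar)
  then have "1 + k = 0"
    using vals[of k] by auto
  moreover have "1 + 1 = (0 :: 'k)"
    using vals[of 1] by (metis add_cancel_left_right insertE singletonD zero_neq_one)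
  ultimately show False
    using \<open>k \<noteq> 1\<close> by (metis add_left_cancel)
qed

lemma large_mono: "A \<subseteq> B \<Longrightarrow> large A \<Longrightarrow> large B"
  using large_disjoint[of A "- B"] large_Compl[of B] by blast

lemma large_Int: "large (A \<inter> B) \<longleftrightarrow> large A \<and> large B"
proof
  assume AB: "large A \<and> large B"
  have "f (idem_fi A) = f (idem_fi (A \<inter> B)) + f (idem_fi (A - B))"
    using idem_fi_Un[of "A \<inter> B" "A - B"] by (metis Int_Diff_Un Int_Diff_disjoint add)
  moreover have "\<not> large (A - B)"
    using large_disjoint[of "A - B" B] AB by blast
  ultimately show "large (A \<inter> B)"
    using AB by (simp add: idem_value split: if_splits)
qed (use large_mono[of "A \<inter> B"] in blast)

lemma large_level_set: "large (level_set k a) \<longleftrightarrow> k = f a"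
proof -
  have *: "large (level_set (f a) a)"
  proof (rule ccontr)
    \<comment> \<open>The idempotent puts 1 exactly where the diagonal of
      \<open>a - scale_fi (f a) 1\<close> vanishes, and contributes 0 to the value of
      \<open>f\<close> when the level set is not large.\<close>
    let ?b = "a - scale_fi (f a) 1 + idem_fi (level_set (f a) a)"
    assume "\<not> large (level_set (f a) a)"
    then have "f ?b = 0"
      by (simp add: add diff scale one idem_value)
    moreover have "?b \<in> unit_elems"
      by (auto simp: unit_iff_diag_nonzero coef_one coef_idem level_set_def)
    ultimately show False
      using unit_nonzero by blast
  qed
  have "level_set k a \<inter> level_set (f a) a = {}" if "k \<noteq> f a"
    using that by (auto simp: level_set_def)
  then show ?thesis
    using * large_disjoint by blast
qed

text \<open>Indices are scalars, so a choice of an index for each point is the diagonal of an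
  element. The value of \<open>f\<close> there singles out one index \<open>k\<close>, and on a
  large part of the union the choice equals \<open>k\<close>, which puts that part inside
  \<open>A k\<close>.\<close>

lemma large_UN:
  fixes I :: "'k set"
  shows "large (\<Union>i\<in>I. A i) \<longleftrightarrow> (\<exists>i\<in>I. large (A i))"
proof
  assume large: "large (\<Union>i\<in>I. A i)"
  then obtain j where j: "j \<in> I"
    using not_large_empty by force
  \<comment> \<open>The default \<open>j\<close> is taken from \<open>I\<close> so that every
    diagonal value, and hence \<open>k\<close>, lies in \<open>I\<close>.\<close>
  define d where "d x = (if x \<in> (\<Union>i\<in>I. A i) then SOME i. i \<in> I \<and> x \<in> A i else j)" for x
  have d: "d x \<in> I \<and> x \<in> A (d x)" if "x \<in> (\<Union>i\<in>I. A i)" for x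
    using that someI_ex[of "\<lambda>i. i \<in> I \<and> x \<in> A i"] unfolding d_def by auto
  define k where "k = f (diag_fi d)"
  obtain x where "d x = k"
    using obtain_value[of "diag_fi d"] unfolding k_def by (auto simp: coef_diag)
  then have "k \<in> I"
    using d j unfolding d_def by metis
  have "large (level_set k (diag_fi d) \<inter> (\<Union>i\<in>I. A i))"
    using large large_Int large_level_set unfolding k_def by blast
  moreover have "level_set k (diag_fi d) \<inter> (\<Union>i\<in>I. A i) \<subseteq> A k"
    using d by (auto simp: level_set_def coef_diag)
  ultimately show "\<exists>i\<in>I. large (A i)"
    using \<open>k \<in> I\<close> large_mono by blast
qed (use large_mono in blast)

end

end

section \<open>The diagonal map induced by a complete endomorphism\<close>

lemma coef_sum_idem_offdiag: "x \<noteq> y \<Longrightarrow> coef (sum_idem B) x y = 0"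
  by transfer simp

lemma boolean_endo_mono: "boolean_endo l \<Longrightarrow> A \<subseteq> B \<Longrightarrow> l A \<subseteq> l B"
  unfolding boolean_endo_def by (metis sup.absorb_iff2)

context
  fixes l :: "'a::order set \<Rightarrow> 'a set"
  assumes l: "complete_endo |UNIV :: 'k::field set| l"
begin

lemma endo: "boolean_endo l"
  using l by (simp add: complete_endo_def)

text \<open>The level sets partition the poset into pieces indexed by the field, so completeness
  makes their images cover it. Their disjointness, used in \<open>coef_sum_idem_level\<close>, makes
  the level at \<open>x\<close> unique.\<close>

lemma obtain_endo_level:
  fixes a :: "('a, 'k) fin_inc_alg"
  obtains k where "x \<in> l (level_set k a)"
proof -
  have "l (\<Union>k\<in>(UNIV :: 'k set). level_set k a) = (\<Union>k\<in>UNIV. l (level_set k a))"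
    by (rule complete_endo_UN[OF card_of_Card_order l card_of_mono1[OF subset_refl]])
  moreover have "(\<Union>k\<in>UNIV. level_set k a) = UNIV"
    by (auto simp: level_set_def)
  moreover have "l UNIV = UNIV"
    using endo by (simp add: boolean_endo_def)
  ultimately show thesis
    using that by auto
qed

lemma coef_sum_idem_level:
  fixes a :: "('a, 'k) fin_inc_alg"
  assumes "x \<in> l (level_set k a)"
  shows "coef (sum_idem (\<lambda>k. l (level_set k a))) x x = k"
proof (rule coef_sum_idem[where B = "\<lambda>k. l (level_set k a)", OF _ assms])
  fix i j :: 'k
  assume "i \<noteq> j"
  then have "level_set i a \<inter> level_set j a = {}"
    by (auto simp: level_set_def)
  then have "l (level_set i a \<inter> level_set j a) = {}"
    using endo by (simp add: boolean_endo_def)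
  then show "l (level_set i a) \<inter> l (level_set j a) = {}"
    using endo by (simp add: boolean_endo_def)
qed

lemma sum_idem_level_add:
  fixes a b :: "('a, 'k) fin_inc_alg"
  shows "sum_idem (\<lambda>k. l (level_set k (a + b))) =
    sum_idem (\<lambda>k. l (level_set k a)) + sum_idem (\<lambda>k. l (level_set k b))"
proof (rule fin_inc_alg_eqI)
  fix x y :: 'a
  obtain i where i: "x \<in> l (level_set i a)"
    by (rule obtain_endo_level)
  obtain j where j: "x \<in> l (level_set j b)"
    by (rule obtain_endo_level)
  have "x \<in> l (level_set i a \<inter> level_set j b)"
    using i j endo by (simp add: boolean_endo_def)
  \<comment> \<open>Additivity is reduced to this inclusion of level sets: monotonicity of
    \<open>l\<close> carries it to the point \<open>x\<close>.\<close>
  moreover have "level_set i a \<inter> level_set j b \<subseteq> level_set (i + j) (a + b)"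
    by (auto simp: level_set_def)
  ultimately have "x \<in> l (level_set (i + j) (a + b))"
    using boolean_endo_mono[OF endo] by blast
  then show "coef (sum_idem (\<lambda>k. l (level_set k (a + b)))) x y =
    coef (sum_idem (\<lambda>k. l (level_set k a)) + sum_idem (\<lambda>k. l (level_set k b))) x y"
    using i j by (cases "x = y") (simp_all add: coef_sum_idem_level coef_sum_idem_offdiag)
qed

lemma sum_idem_level_scale:
  fixes a :: "('a, 'k) fin_inc_alg"
  shows "sum_idem (\<lambda>k. l (level_set k (scale_fi c a))) =
    scale_fi c (sum_idem (\<lambda>k. l (level_set k a)))"
proof (rule fin_inc_alg_eqI)
  fix x y :: 'a
  obtain i where i: "x \<in> l (level_set i a)"
    by (rule obtain_endo_level)
  moreover have "level_set i a \<subseteq> level_set (c * i) (scale_fi c a)"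
    by (auto simp: level_set_def)
  ultimately have "x \<in> l (level_set (c * i) (scale_fi c a))"
    using boolean_endo_mono[OF endo] by blast
  then show "coef (sum_idem (\<lambda>k. l (level_set k (scale_fi c a)))) x y =
    coef (scale_fi c (sum_idem (\<lambda>k. l (level_set k a)))) x y"
    using i by (cases "x = y") (simp_all add: coef_sum_idem_level coef_sum_idem_offdiag)
qed

lemma sum_idem_level_one: "sum_idem (\<lambda>k. l (level_set k (1 :: ('a, 'k) fin_inc_alg))) = 1"
proof (rule fin_inc_alg_eqI)
  fix x y :: 'a
  have "level_set 1 (1 :: ('a, 'k) fin_inc_alg) = UNIV"
    by (auto simp: level_set_def coef_one)
  then have "x \<in> l (level_set 1 (1 :: ('a, 'k) fin_inc_alg))"
    using endo by (simp add: boolean_endo_def)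
  then show "coef (sum_idem (\<lambda>k. l (level_set k (1 :: ('a, 'k) fin_inc_alg)))) x y = coef 1 x y"
    by (cases "x = y") (simp_all add: coef_sum_idem_level coef_sum_idem_offdiag coef_one)
qed

text \<open>A unit has empty level set at 0, and \<open>l\<close> keeps it empty, so 0 does not
  occur as a diagonal value; adding a radical element leaves the diagonal unchanged.\<close>

lemma sum_idem_level_plus_rad_unit:
  fixes a r :: "('a, 'k) fin_inc_alg"
  assumes a: "a \<in> unit_elems" and r: "r \<in> rad_fi"
  shows "sum_idem (\<lambda>k. l (level_set k a)) + r \<in> unit_elems"
  unfolding unit_iff_diag_nonzero
proof
  fix x
  obtain k where k: "x \<in> l (level_set k a)"
    by (rule obtain_endo_level)
  have "level_set 0 a = {}"
    using a by (auto simp: level_set_def unit_iff_diag_nonzero)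
  then have "k \<noteq> 0"
    using k endo by (auto simp: boolean_endo_def)
  then show "coef (sum_idem (\<lambda>k. l (level_set k a)) + r) x x \<noteq> 0"
    using r k by (simp add: coef_sum_idem_level rad_fi_def)
qed

end

section \<open>Both directions of the characterization\<close>

lemma linear_scale_fi_iff:
  "Vector_Spaces.linear scale_fi scale_fi \<phi> \<longleftrightarrow>
    (\<forall>a b. \<phi> (a + b) = \<phi> a + \<phi> b) \<and> (\<forall>c a. \<phi> (scale_fi c a) = scale_fi c (\<phi> a))"
  by (simp add: Vector_Spaces.linear_iff fin_inc_alg.vector_space_axioms)

theorem theorem2p12:
  fixes \<phi> :: "('a::order, 'k::field) fin_inc_alg \<Rightarrow> ('a, 'k) fin_inc_alg"
  assumes "infinite (UNIV :: 'k set) \<or> card (UNIV :: 'k set) > 2"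
  shows "unital \<phi> \<and> Vector_Spaces.linear scale_fi scale_fi \<phi> \<and> invertibility_preserver \<phi>
    \<longleftrightarrow>
    (\<exists>(l :: 'a set \<Rightarrow> 'a set) (\<psi> :: ('a, 'k) fin_inc_alg \<Rightarrow> ('a, 'k) fin_inc_alg).
       complete_endo |UNIV :: 'k set| l \<and>
       Vector_Spaces.linear scale_fi scale_fi \<psi> \<and> range \<psi> \<subseteq> rad_fi \<and> \<psi> 1 = 0 \<and>
       (\<forall>\<alpha>. \<phi> \<alpha> = sum_idem (\<lambda>k. l (level_set k \<alpha>)) + \<psi> \<alpha>))"
    (is "?lhs \<longleftrightarrow> ?rhs")
proof
  assume ?lhs
  then have one: "\<phi> 1 = 1" and add: "\<And>a b. \<phi> (a + b) = \<phi> a + \<phi> b"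
    and scale: "\<And>c a. \<phi> (scale_fi c a) = scale_fi c (\<phi> a)"
    and inv: "\<And>a. a \<in> unit_elems \<Longrightarrow> \<phi> a \<in> unit_elems"
    unfolding unital_def invertibility_preserver_def linear_scale_fi_iff by auto
  define f where "f x a = coef (\<phi> a) x x" for x a
  interpret f: unital_functional "f x" for x
    by unfold_locales (use inv in \<open>auto simp: f_def one add scale coef_one unit_iff_diag_nonzero\<close>)
  define l where "l A = {x. f.large x A}" for A
  have "boolean_endo l"
    unfolding boolean_endo_def
  proof (intro conjI allI)
    fix A B
    show Int: "l (A \<inter> B) = l A \<inter> l B" for A B
      by (auto simp: l_def f.large_Int[OF assms])
    show Compl: "l (- A) = - l A" for A
      by (auto simp: l_def f.large_Compl)
    show "l (A \<union> B) = l A \<union> l B"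
      using Int[of "- A" "- B"] Compl[of "A \<union> B"] Compl[of A] Compl[of B] by auto
    show "l {} = {}" "l UNIV = UNIV"
      by (simp_all add: l_def f.not_large_empty f.large_UNIV)
  qed
  then have l: "complete_endo |UNIV :: 'k set| l"
    unfolding complete_endo_def by (auto simp: l_def f.large_UN[OF assms])
  let ?D = "\<lambda>a :: ('a, 'k) fin_inc_alg. sum_idem (\<lambda>k. l (level_set k a))"
  \<comment> \<open>By \<open>large_level_set\<close>, \<open>x\<close> lies in the image of the
    level set for the scalar \<open>f x a\<close>, so \<open>?D a\<close> recovers the diagonal of
    \<open>\<phi> a\<close>.\<close>
  have D: "coef (?D a) x x = coef (\<phi> a) x x" for a x
    using coef_sum_idem_level[OF l, of x "f x a" a]
    by (simp add: l_def f.large_level_set[OF assms] f_def)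
  \<comment> \<open>The difference has zero diagonal, and it is linear because \<open>?D\<close> is
    linear as well as \<phi>.\<close>
  define \<psi> where "\<psi> a = \<phi> a - ?D a" for a
  have "Vector_Spaces.linear scale_fi scale_fi \<psi>"
    unfolding linear_scale_fi_iff \<psi>_def
    by (auto simp: add scale sum_idem_level_add[OF l] sum_idem_level_scale[OF l]
        fin_inc_alg.scale_right_diff_distrib)
  moreover have "range \<psi> \<subseteq> rad_fi"
    by (auto simp: \<psi>_def rad_fi_def D)
  moreover have "\<psi> 1 = 0"
    by (simp add: \<psi>_def one sum_idem_level_one[OF l])
  moreover have "\<phi> \<alpha> = ?D \<alpha> + \<psi> \<alpha>" for \<alpha>
    by (simp add: \<psi>_def)
  ultimately show ?rhs
    using l by blast
next
  assume ?rhs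
  then obtain l :: "'a set \<Rightarrow> 'a set" and \<psi> :: "('a, 'k) fin_inc_alg \<Rightarrow> ('a, 'k) fin_inc_alg"
    where l: "complete_endo |UNIV :: 'k set| l"
      and \<psi>: "Vector_Spaces.linear scale_fi scale_fi \<psi>" "range \<psi> \<subseteq> rad_fi" "\<psi> 1 = 0"
      and \<phi>: "\<And>\<alpha>. \<phi> \<alpha> = sum_idem (\<lambda>k. l (level_set k \<alpha>)) + \<psi> \<alpha>"
    by blast
  have "unital \<phi>"
    by (simp add: unital_def \<phi> \<psi> sum_idem_level_one[OF l])
  moreover have "Vector_Spaces.linear scale_fi scale_fi \<phi>"
    using \<psi>(1) unfolding linear_scale_fi_iff \<phi>
    by (simp add: sum_idem_level_add[OF l] sum_idem_level_scale[OF l]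
        fin_inc_alg.scale_right_distrib)
  moreover have "invertibility_preserver \<phi>"
    unfolding invertibility_preserver_def \<phi>
    using sum_idem_level_plus_rad_unit[OF l] \<psi>(2) by blast
  ultimately show ?lhs by blast
qed

end
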